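(* Fix an even $N$, $n\ge1$ with $2n\le N$, a confidence bound $\Delta\in[0,\pi]$ and $\omega_0\ge0$. Suppose that a cluster of $2n$ oscillators ($n$ with natural frequency $\omega_0$, $n$ with natural frequency $-\omega_0$) admits both a linearly stable fixed point in the all-to-all configuration and a linearly stable fixed point in a sparse configuration. Let $0=\lambda_1>\lambda_2\ge\dots\ge\lambda_{2n}$ and $0=\lambda_1'>\lambda_2'\ge\dots\ge\lambda_{2n}'$ be the eigenvalues of the Jacobian (stability matrix) at the all-to-all and at the sparse fixed point, respectively. Then the largest non-vanishing eigenvalue is smaller for the all-to-all fixed point: $\lambda_2<\lambda_2'$.
   Context: Model: $N$ oscillators with phases $\theta_i\in\mathbb S^1$ evolve by $\dot\theta_i=\omega_i-\frac1N\sum_{j=1}^N a_{ij}\sin(\theta_i-\theta_j)$, where $a_{ij}=1$ if $\|\theta_i-\theta_j\|\le\Delta$ and $0$ otherwise, $\|\cdot\|$ being geodesic distance on $\mathbb S^1$. The natural frequencies are $\omega_i=\omega_0$ for $i\in\bm I_+$ and $\omega_i=-\omega_0$ for $i\in\bm I_-$. A cluster of a fixed point is a connected component of the graph with adjacency matrix $(a_{ij})$ at that fixed point. A fixed point for a cluster $\Lambda$ of $2n$ oscillators ($n$ from $\bm I_+$, $n$ from $\bm I_-$) is a phase configuration $(\theta_i)_{i\in\Lambda}$ whose graph $(a_{ij})_{i,j\in\Lambda}$ is connected and which satisfies $\omega_i=\frac1N\sum_{j\in\Lambda}a_{ij}\sin(\theta_i-\theta_j)$ for all $i\in\Lambda$.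 It is in the all-to-all configuration if the graph is complete ($a_{ij}=1$ for all $i,j\in\Lambda$) and the oscillators form two groups: all those in $\bm I_+$ share a phase $\theta_+$ and all those in $\bm I_-$ share a phase $\theta_-$. It is in a sparse configuration if the graph is connected but not complete. The Jacobian is the $2n\times2n$ matrix $\mathcal J_{ij}=a_{ij}\cos(\theta_i-\theta_j)$ for $i\ne j$, $\mathcal J_{ii}=-\sum_{k\in\Lambda,k\ne i}a_{ik}\cos(\theta_i-\theta_k)$, evaluated at the fixed point (with the $a_{ij}$ of that fixed point). It has eigenvalue $\lambda_1=0$ with eigenvector $(1,\dots,1)$; the fixed point is linearly stable if the other $2n-1$ eigenvalues (with multiplicity) are strictly negative. *)

theory Defs
  imports "HOL-Analysis.Analysis" "HOL-Library.Real_Mod" "Jordan_Normal_Form.Char_Poly"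
begin

text \<open>
  Points of the circle are given by real representatives modulo \<open>2 * pi\<close>; a phase configuration
  assigns such a representative to every oscillator. Equality of phases is therefore
  congruence modulo \<open>2 * pi\<close>, and the geodesic distance is the quotient distance.
\<close>

definition geodist :: "real \<Rightarrow> real \<Rightarrow> real" where
  "geodist x y = (INF k::int. \<bar>x - y + 2 * pi * of_int k\<bar>)"

definition adj :: "real \<Rightarrow> (nat \<Rightarrow> real) \<Rightarrow> nat \<Rightarrow> nat \<Rightarrow> real" where
  "adj \<Delta> \<theta> i j = (if geodist (\<theta> i) (\<theta> j) \<le> \<Delta> then 1 else 0)"

definition connected_graph :: "real \<Rightarrow> nat set \<Rightarrow> (nat \<Rightarrow> real) \<Rightarrow> bool" where
  "connected_graph \<Delta> \<Lambda> \<theta> \<longleftrightarrow>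
     (\<forall>i\<in>\<Lambda>. \<forall>j\<in>\<Lambda>. (i, j) \<in> {(k, l). k \<in> \<Lambda> \<and> l \<in> \<Lambda> \<and> adj \<Delta> \<theta> k l = 1}\<^sup>*)"

definition complete_graph :: "real \<Rightarrow> nat set \<Rightarrow> (nat \<Rightarrow> real) \<Rightarrow> bool" where
  "complete_graph \<Delta> \<Lambda> \<theta> \<longleftrightarrow> (\<forall>i\<in>\<Lambda>. \<forall>j\<in>\<Lambda>. adj \<Delta> \<theta> i j = 1)"

definition cluster_fixed_point ::
  "nat \<Rightarrow> real \<Rightarrow> (nat \<Rightarrow> real) \<Rightarrow> nat set \<Rightarrow> (nat \<Rightarrow> real) \<Rightarrow> bool" where
  "cluster_fixed_point N \<Delta> \<omega> \<Lambda> \<theta> \<longleftrightarrow>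
     connected_graph \<Delta> \<Lambda> \<theta> \<and>
     (\<forall>i\<in>\<Lambda>. \<omega> i = 1 / real N * (\<Sum>j\<in>\<Lambda>. adj \<Delta> \<theta> i j * sin (\<theta> i - \<theta> j)))"

definition all_to_all_config ::
  "real \<Rightarrow> nat set \<Rightarrow> nat set \<Rightarrow> nat set \<Rightarrow> (nat \<Rightarrow> real) \<Rightarrow> bool" where
  "all_to_all_config \<Delta> Iplus Iminus \<Lambda> \<theta> \<longleftrightarrow>
     complete_graph \<Delta> \<Lambda> \<theta> \<and>
     (\<exists>\<theta>plus. \<forall>i\<in>\<Lambda> \<inter> Iplus. [\<theta> i = \<theta>plus] (rmod (2 * pi))) \<and>
     (\<exists>\<theta>minus. \<forall>i\<in>\<Lambda> \<inter> Iminus. [\<theta> i = \<theta>minus] (rmod (2 * pi)))"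

definition sparse_config :: "real \<Rightarrow> nat set \<Rightarrow> (nat \<Rightarrow> real) \<Rightarrow> bool" where
  "sparse_config \<Delta> \<Lambda> \<theta> \<longleftrightarrow> connected_graph \<Delta> \<Lambda> \<theta> \<and> \<not> complete_graph \<Delta> \<Lambda> \<theta>"

definition stability_entry ::
  "real \<Rightarrow> nat set \<Rightarrow> (nat \<Rightarrow> real) \<Rightarrow> nat \<Rightarrow> nat \<Rightarrow> real" where
  "stability_entry \<Delta> \<Lambda> \<theta> i j =
     (if i = j then - (\<Sum>k\<in>\<Lambda> - {i}. adj \<Delta> \<theta> i k * cos (\<theta> i - \<theta> k))
      else adj \<Delta> \<theta> i j * cos (\<theta> i - \<theta> j))"

text \<open>Rows and columns follow the increasing enumeration of \<open>\<Lambda>\<close>, as matrices are indexed from 0.\<close>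

definition stability_matrix :: "real \<Rightarrow> nat set \<Rightarrow> (nat \<Rightarrow> real) \<Rightarrow> real mat" where
  "stability_matrix \<Delta> \<Lambda> \<theta> =
     mat (card \<Lambda>) (card \<Lambda>)
       (\<lambda>(p, q). stability_entry \<Delta> \<Lambda> \<theta> (sorted_list_of_set \<Lambda> ! p) (sorted_list_of_set \<Lambda> ! q))"

text \<open>
  \<open>ev 1 \<ge> ev 2 \<ge> \<dots>\<close> are all the eigenvalues of \<open>A\<close>, listed with algebraic multiplicity; since the
  matrix is real and symmetric in the application, such a list exists and the multiplicities
  are also the geometric ones. Values of \<open>ev\<close> outside \<open>{1..dim_row A}\<close> are irrelevant.
\<close>

definition ordered_eigenvalues :: "real mat \<Rightarrow> (nat \<Rightarrow> real) \<Rightarrow> bool" where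
  "ordered_eigenvalues A ev \<longleftrightarrow>
     char_poly A = (\<Prod>k=1..dim_row A. [:- ev k, 1:]) \<and>
     (\<forall>j k. 1 \<le> j \<and> j \<le> k \<and> k \<le> dim_row A \<longrightarrow> ev k \<le> ev j)"

definition linearly_stable :: "real \<Rightarrow> nat set \<Rightarrow> (nat \<Rightarrow> real) \<Rightarrow> bool" where
  "linearly_stable \<Delta> \<Lambda> \<theta> \<longleftrightarrow>
     (\<exists>ev. ordered_eigenvalues (stability_matrix \<Delta> \<Lambda> \<theta>) ev \<and> ev 1 = 0 \<and> (\<forall>k\<in>{2..card \<Lambda>}. ev k < 0))"

end

theory Submission
  imports Defs "Jordan_Normal_Form.Schur_Decomposition"
begin

text \<open>
  Testing the Rayleigh quotient on the vector that is \<open>1\<close> on the positive and \<open>-1\<close> on the negative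
  oscillators gives \<open>\<lambda>\<^sub>2' \<ge> - (2 / n) * S\<close>, where \<open>S\<close> is the sum of the
  \<open>a\<^sub>i\<^sub>j cos (\<theta>\<^sub>i' - \<theta>\<^sub>j')\<close> over all mixed pairs. Summing the fixed-point equations over the
  positive oscillators shows that the corresponding sine sum is \<open>n * N * \<omega>\<^sub>0 = n\<^sup>2 * sin \<phi>\<close>,
  with \<open>\<phi>\<close> the phase gap of the all-to-all state. Hence \<open>cos \<phi> * S + n\<^sup>2 * (sin \<phi>)\<^sup>2\<close> is the sum of the
  \<open>a\<^sub>i\<^sub>j cos (\<theta>\<^sub>i' - \<theta>\<^sub>j' - \<phi>)\<close>, which is at most \<open>n\<^sup>2\<close>, with equality only for two fully
  linked groups, i.e. for a complete graph. So \<open>S < n\<^sup>2 * cos \<phi>\<close>, whereas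
  \<open>\<lambda>\<^sub>2 \<le> - 2 * n * cos \<phi>\<close> at the all-to-all state.
\<close>

unbundle no vec_syntax
unbundle no inner_syntax

section \<open>Spectral theorem for real symmetric matrices\<close>

text \<open>Complete \<open>v\<close> to a basis, orthogonalise by Gram-Schmidt, which keeps the
  first vector, and normalise. This supplies the change of basis that splits off an eigenvector in
  the diagonalisation below.\<close>

lemma orthonormal_completion:
  fixes v :: "real vec"
  assumes v: "v \<in> carrier_vec n" and norm: "v \<bullet> v = 1"
  shows "\<exists>W \<in> carrier_mat n n. transpose_mat W * W = 1\<^sub>m n \<and> col W 0 = v"
proof -
  interpret cof_vec_space n "TYPE(real)" .
  have v0: "v \<noteq> 0\<^sub>v n" using norm by auto
  have n: "0 < n"
  proof (rule ccontr)
    assume "\<not> 0 < n"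
    then show False using v norm by (auto simp: scalar_prod_def)
  qed
  define b where "b = basis_completion v"
  define ws where "ws = gram_schmidt n b"
  note bc = basis_completion[OF v v0, folded b_def]
  from gram_schmidt_result[OF bc(2,4,5) refl, folded ws_def] bc(6)
  have ws: "set ws \<subseteq> carrier_vec n" "corthogonal ws" "length ws = n" by auto
  from bc(6,7) n obtain vs where bv: "b = v # vs" by (cases b) auto
  have hdws: "ws ! 0 = v"
    using gram_schmidt_hd[OF v, of vs, folded bv, folded ws_def] ws(3) n hd_conv_nth[of ws]
    by (cases ws) auto
  have wsc: "ws ! i \<in> carrier_vec n" if "i < n" for i using ws that by auto
  \<comment> \<open>Over the reals conjugation is trivial, so \<open>corthogonal\<close> is ordinary
    orthogonality.\<close>
  have conj: "conjugate w = w" for w :: "real vec" by (rule eq_vecI) auto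
  have orth: "(ws ! i \<bullet> ws ! j = 0) = (i \<noteq> j)" if "i < n" "j < n" for i j
    using corthogonalD[OF ws(2)] that ws(3) by (simp add: conj)
  have pos: "ws ! i \<bullet> ws ! i > 0" if "i < n" for i
  proof -
    have "ws ! i \<bullet> ws ! i \<ge> 0" by (auto simp: scalar_prod_def intro!: sum_nonneg)
    with orth[OF that that] show ?thesis by auto
  qed
  define us where "us = map (\<lambda>w. (1 / sqrt (w \<bullet> w)) \<cdot>\<^sub>v w) ws"
  have us: "us ! i = (1 / sqrt (ws ! i \<bullet> ws ! i)) \<cdot>\<^sub>v (ws ! i)" if "i < n" for i
    using that ws(3) by (simp add: us_def)
  define W where "W = mat_of_cols n us"
  have W: "W \<in> carrier_mat n n" using ws(3) by (auto simp: W_def us_def)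
  have colW: "col W i = us ! i" if "i < n" for i
    unfolding W_def using that ws(3) us[OF that] wsc[OF that]
    by (intro col_mat_of_cols) (auto simp: us_def)
  have "transpose_mat W * W = 1\<^sub>m n"
  proof (rule eq_matI)
    fix i j assume "i < dim_row (1\<^sub>m n :: real mat)" "j < dim_col (1\<^sub>m n :: real mat)"
    then have i: "i < n" and j: "j < n" by auto
    have "(transpose_mat W * W) $$ (i, j) = us ! i \<bullet> us ! j"
      using W i j colW[OF i] colW[OF j] by simp
    also have "\<dots> = (ws ! i \<bullet> ws ! j) / (sqrt (ws ! i \<bullet> ws ! i) * sqrt (ws ! j \<bullet> ws ! j))"
      using us[OF i] us[OF j] wsc[OF i] wsc[OF j] by simp
    also have "\<dots> = (if i = j then 1 else 0)"
      using orth[OF i j] pos[OF i] by auto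
    finally show "(transpose_mat W * W) $$ (i, j) = 1\<^sub>m n $$ (i, j)" using i j by simp
  qed (use W in auto)
  \<comment> \<open>Normalising leaves the first vector alone, as \<open>v\<close> is already a unit
    vector.\<close>
  moreover have "col W 0 = v"
    using colW[OF n] us[OF n] hdws norm v by simp
  ultimately show ?thesis using W by blast
qed

text \<open>The eigenvalues are a list rather than a set or multiset: their order on the diagonal is
  prescribed, so that the first column of \<open>U\<close> can later be matched with the top
  eigenvalue.\<close>

definition orthogonally_diagonalizes :: "real mat \<Rightarrow> real mat \<Rightarrow> real list \<Rightarrow> bool" where
  "orthogonally_diagonalizes U A es \<longleftrightarrow>
     transpose_mat U * U = 1\<^sub>m (length es) \<and>
     transpose_mat U * A * U =
       mat (length es) (length es) (\<lambda>(i, j). if i = j then es ! i else 0)"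

text \<open>Deflation by induction on the eigenvalue list. In an orthonormal basis starting with a
  unit eigenvector for \<open>e\<close>, symmetry makes the matrix block diagonal, with
  \<open>e\<close> in the corner and a smaller symmetric block that has the remaining eigenvalues.
  Since the characteristic polynomial is assumed to split over the reals, no complex eigenvectors
  arise.\<close>

lemma symmetric_orthogonally_diagonalizable:
  fixes A :: "real mat"
  assumes "A \<in> carrier_mat n n" and "transpose_mat A = A"
    and "char_poly A = (\<Prod>e\<leftarrow>es. [:- e, 1:])"
  shows "\<exists>U \<in> carrier_mat n n. orthogonally_diagonalizes U A es"
  using assms
proof (induction es arbitrary: n A)
  case Nil
  then have n: "n = 0" using degree_monic_char_poly[of A n] by auto
  show ?case
    by (rule bexI[of _ "1\<^sub>m 0"]) (use Nil(1) n in \<open>auto simp: orthogonally_diagonalizes_def\<close>)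
next
  case (Cons e es n A)
  note A = Cons.prems(1) and sym = Cons.prems(2)
  define m where "m = n - 1"
  have e: "eigenvalue A e" unfolding eigenvalue_root_char_poly[OF A] Cons.prems(3) by simp
  then obtain w where w: "w \<in> carrier_vec n" "w \<noteq> 0\<^sub>v n" "A *\<^sub>v w = e \<cdot>\<^sub>v w"
    using A unfolding eigenvalue_def eigenvector_def by auto
  have len: "length (e # es) = n"
  proof -
    have "degree (\<Prod>e\<leftarrow>es. [:- e, 1:]) = length es" for es :: "real list"
    proof (induction es)
      case (Cons a es)
      have "(\<Prod>e\<leftarrow>es. [:- e, 1:]) \<noteq> 0" by (auto simp: prod_list_zero_iff)
      then have "degree ([:- a, 1:] * (\<Prod>e\<leftarrow>es. [:- e, 1:])) = 1 + degree (\<Prod>e\<leftarrow>es. [:- e, 1:])"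
        by (subst degree_mult_eq) auto
      then show ?case using Cons.IH by simp
    qed simp
    then show ?thesis using degree_monic_char_poly[OF A] Cons.prems(3) by metis
  qed
  then have n: "n = Suc m" by (auto simp: m_def)
  have conj: "conjugate w = w" for w :: "real vec" by (rule eq_vecI) auto
  have "w \<bullet> w \<noteq> 0" using conjugate_square_eq_0_vec[OF w(1)] w(2) by (simp add: conj)
  moreover have "w \<bullet> w \<ge> 0" by (auto simp: scalar_prod_def intro!: sum_nonneg)
  ultimately have ww: "w \<bullet> w > 0" by simp
  define v where "v = (1 / sqrt (w \<bullet> w)) \<cdot>\<^sub>v w"
  have v: "v \<in> carrier_vec n" using w by (simp add: v_def)
  have vv: "v \<bullet> v = 1" using w ww by (simp add: v_def)
  have Av: "A *\<^sub>v v = e \<cdot>\<^sub>v v"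
    unfolding v_def using w(3) mult_mat_vec[OF A w(1)] by (simp add: smult_smult_assoc mult.commute)
  obtain W where W: "W \<in> carrier_mat n n" and WW: "transpose_mat W * W = 1\<^sub>m n"
    and W0: "col W 0 = v"
    using orthonormal_completion[OF v vv] by auto
  have Wt: "transpose_mat W \<in> carrier_mat n n" using W by simp
  have WW': "W * transpose_mat W = 1\<^sub>m n"
    using mat_mult_left_right_inverse[OF Wt W WW] .
  define B where "B = transpose_mat W * A * W"
  have B: "B \<in> carrier_mat n n" using W A by (simp add: B_def)
  have symB: "transpose_mat B = B"
    unfolding B_def using W A sym
    by (simp add: transpose_mult[of _ n n _ n] assoc_mult_mat[of _ n n _ n _ n])
  \<comment> \<open>The first column of \<open>W\<close> is the eigenvector, so the first column of
    \<open>B\<close> is \<open>e\<close> times that of \<open>transpose_mat W * W\<close>. Symmetry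
    then gives the first row.\<close>
  have B0: "B $$ (i, 0) = (if i = 0 then e else 0)" if i: "i < n" for i
  proof -
    have "B = transpose_mat W * (A * W)" using W A by (simp add: B_def)
    then have "B $$ (i, 0) = col W i \<bullet> (A *\<^sub>v col W 0)"
      using W A i n by (simp add: mult_mat_vec_def)
    also have "\<dots> = e * (col W i \<bullet> col W 0)"
      unfolding W0 Av using W v i by simp
    also have "col W i \<bullet> col W 0 = (transpose_mat W * W) $$ (i, 0)" using W i n by simp
    finally show ?thesis unfolding WW using i n by simp
  qed
  have B0': "B $$ (0, i) = (if i = 0 then e else 0)" if "i < n" for i
  proof -
    have "B $$ (0, i) = transpose_mat B $$ (i, 0)" using B that n by simp
    then show ?thesis using symB B0[OF that] by simp
  qed
  define A3 where "A3 = mat m m (\<lambda>(i, j). B $$ (Suc i, Suc j))"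
  have A3: "A3 \<in> carrier_mat m m" by (simp add: A3_def)
  define A1 where "A1 = mat 1 1 (\<lambda>_. e)"
  have A1: "A1 \<in> carrier_mat 1 1" by (simp add: A1_def)
  have Bblock: "B = four_block_mat A1 (0\<^sub>m 1 m) (0\<^sub>m m 1) A3"
    by (rule eq_matI) (use B n B0 B0' in \<open>auto simp: A1_def A3_def not_less_eq\<close>)
  \<comment> \<open>Similarity preserves the characteristic polynomial; cancelling the factor of the
    corner block leaves the one required of \<open>A3\<close> by the induction hypothesis.\<close>
  have "similar_mat B A"
    unfolding similar_mat_def
    by (intro exI, rule similar_mat_witI[of "transpose_mat W" W n B A]) (use W A B WW WW' in \<open>auto simp: B_def\<close>)
  then have "char_poly B = [:- e, 1:] * (\<Prod>e\<leftarrow>es. [:- e, 1:])"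
    using char_poly_similar Cons.prems(3) by fastforce
  also have "char_poly B = char_poly A1 * char_poly A3"
    unfolding Bblock by (rule char_poly_four_block_zeros_col[OF A1 _ A3]) simp
  also have "char_poly A1 = [:- e, 1:]"
    by (simp add: A1_def char_poly_defs det_def sign_def)
  finally have cp3: "char_poly A3 = (\<Prod>e\<leftarrow>es. [:- e, 1:])"
    by (metis mult_cancel_left pCons_eq_0_iff zero_neq_one)
  have "transpose_mat A3 = A3"
  proof (rule eq_matI)
    fix i j assume "i < dim_row A3" "j < dim_col A3"
    then have "i < m" "j < m" using A3 by auto
    then have "A3 $$ (j, i) = transpose_mat B $$ (Suc i, Suc j)"
      using B n by (simp add: A3_def)
    then show "transpose_mat A3 $$ (i, j) = A3 $$ (i, j)"
      using \<open>i < m\<close> \<open>j < m\<close> symB by (simp add: A3_def)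
  qed (use A3 in auto)
  from Cons.IH[OF A3 this cp3] obtain V where V: "V \<in> carrier_mat m m"
    and VV: "transpose_mat V * V = 1\<^sub>m m"
    and VA: "transpose_mat V * A3 * V = mat m m (\<lambda>(i, j). if i = j then es ! i else 0)"
    using len n by (auto simp: orthogonally_diagonalizes_def)
  \<comment> \<open>Bordering \<open>V\<close> by 1 keeps the split-off eigenvector fixed; the
    diagonalising matrix is \<open>W * P\<close>.\<close>
  define P where "P = four_block_mat (1\<^sub>m 1) (0\<^sub>m 1 m) (0\<^sub>m m 1) V"
  have P: "P \<in> carrier_mat n n"
    unfolding P_def n using four_block_carrier_mat[OF one_carrier_mat V, of 1] by simp
  have Pt: "transpose_mat P = four_block_mat (1\<^sub>m 1) (0\<^sub>m 1 m) (0\<^sub>m m 1) (transpose_mat V)"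
    unfolding P_def using V by (subst transpose_four_block_mat[of _ 1 1 _ m _ m]) auto
  have PP: "transpose_mat P * P = 1\<^sub>m n"
    unfolding Pt unfolding P_def using V VV n
    by (subst mult_four_block_mat[of _ 1 1 _ m _ m _ _ 1 _ m]) auto
  have "transpose_mat P * B * P = four_block_mat A1 (0\<^sub>m 1 m) (0\<^sub>m m 1) (transpose_mat V * A3 * V)"
    unfolding Pt unfolding P_def Bblock using V A1 A3
    by (simp add: mult_four_block_mat[of _ 1 1 _ m _ m _ _ 1 _ m])
  also have "\<dots> = mat n n (\<lambda>(i, j). if i = j then (e # es) ! i else 0)"
    unfolding VA by (rule eq_matI) (use n in \<open>auto simp: A1_def\<close>)
  finally have PBP: "transpose_mat P * B * P = \<dots>" .
  have "transpose_mat (W * P) * (W * P) = transpose_mat P * ((transpose_mat W * W) * P)"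
    using W P by (simp add: transpose_mult[of _ n n _ n] assoc_mult_mat[of _ n n _ n _ n])
  then have "transpose_mat (W * P) * (W * P) = 1\<^sub>m n" using WW PP P by simp
  moreover have "transpose_mat (W * P) * A * (W * P) = transpose_mat P * B * P"
    using W P A by (simp add: B_def transpose_mult[of _ n n _ n] assoc_mult_mat[of _ n n _ n _ n])
  ultimately have "orthogonally_diagonalizes (W * P) A (e # es)"
    unfolding orthogonally_diagonalizes_def len PBP by blast
  moreover have "W * P \<in> carrier_mat n n" using W P by simp
  ultimately show ?case by blast
qed


section \<open>Variational bound and uniqueness for ordered eigenvalues\<close>

lemma ordered_eigenvalues_prod_list:
  "ordered_eigenvalues A ev \<Longrightarrow> char_poly A = (\<Prod>e\<leftarrow>map ev [1..<Suc (dim_row A)]. [:- e, 1:])"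
  by (auto simp: ordered_eigenvalues_def prod.distinct_set_conv_list[symmetric] o_def
      atLeastLessThanSuc_atLeastAtMost simp del: upt_Suc)

text \<open>The gap makes the top eigenspace one-dimensional, so \<open>w\<close> is a multiple of
  the first vector of an orthonormal eigenbasis. A vector orthogonal to \<open>w\<close> has no
  component there, and its other components are weighted by eigenvalues of at most
  \<open>ev 2\<close>.\<close>

lemma rayleigh_second_eigenvalue:
  fixes A :: "real mat"
  assumes A: "A \<in> carrier_mat n n" and sym: "transpose_mat A = A"
    and ev: "ordered_eigenvalues A ev" and gap: "\<forall>k\<in>{2..n}. ev k < ev 1"
    and w: "w \<in> carrier_vec n" "w \<noteq> 0\<^sub>v n" "A *\<^sub>v w = ev 1 \<cdot>\<^sub>v w"
    and x: "x \<in> carrier_vec n" and orth: "x \<bullet> w = 0"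
  shows "x \<bullet> (A *\<^sub>v x) \<le> ev 2 * (x \<bullet> x)"
proof -
  define es where "es = map ev [1..<Suc n]"
  have len: "length es = n" by (simp add: es_def)
  \<comment> \<open>The list counts from 0, the eigenvalues from 1: position 0 belongs to
    \<open>ev 1\<close>.\<close>
  have es: "es ! i = ev (Suc i)" if "i < n" for i
    using that by (simp add: es_def nth_append del: upt_Suc)
  have "char_poly A = (\<Prod>e\<leftarrow>es. [:- e, 1:])"
    using ordered_eigenvalues_prod_list[OF ev] A by (simp add: es_def del: upt_Suc)
  from symmetric_orthogonally_diagonalizable[OF A sym this] obtain U where
    U: "U \<in> carrier_mat n n" and UU: "transpose_mat U * U = 1\<^sub>m n"
    and UAU: "transpose_mat U * A * U = mat n n (\<lambda>(i, j). if i = j then es ! i else 0)"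
    by (auto simp: orthogonally_diagonalizes_def len)
  define D where "D = mat n n (\<lambda>(i, j). if i = j then es ! i else 0)"
  have D: "D \<in> carrier_mat n n" by (simp add: D_def)
  have Ut: "transpose_mat U \<in> carrier_mat n n" using U by simp
  have UU': "U * transpose_mat U = 1\<^sub>m n"
    using mat_mult_left_right_inverse[OF Ut U UU] .
  have expand: "U *\<^sub>v (transpose_mat U *\<^sub>v y) = y" if "y \<in> carrier_vec n" for y
    using assoc_mult_mat_vec[OF U Ut that] UU' that by simp
  have inner: "(transpose_mat U *\<^sub>v y) \<bullet> (transpose_mat U *\<^sub>v z) = y \<bullet> z"
    if "y \<in> carrier_vec n" "z \<in> carrier_vec n" for y z
    using transpose_vec_mult_scalar[OF U _ that(1), of "transpose_mat U *\<^sub>v z"] expand[OF that(2)] that(2) U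
    by simp
  have diag: "transpose_mat U *\<^sub>v (A *\<^sub>v y) = D *\<^sub>v (transpose_mat U *\<^sub>v y)"
    if y: "y \<in> carrier_vec n" for y
  proof -
    have "D *\<^sub>v (transpose_mat U *\<^sub>v y) = (transpose_mat U * A) *\<^sub>v (U *\<^sub>v (transpose_mat U *\<^sub>v y))"
      unfolding D_def UAU[symmetric] using U A y
      by (simp add: assoc_mult_mat_vec[of _ n n _ n])
    then show ?thesis unfolding expand[OF y] using U A y by (simp add: assoc_mult_mat_vec[of _ n n _ n])
  qed
  have D_entry: "(D *\<^sub>v y) $ i = es ! i * y $ i" if "y \<in> carrier_vec n" "i < n" for y i
  proof -
    have "(D *\<^sub>v y) $ i = (\<Sum>j = 0..<n. (if i = j then es ! i else 0) * y $ j)"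
      using that D by (simp add: scalar_prod_def D_def)
    also have "\<dots> = (\<Sum>j = 0..<n. if j = i then es ! i * y $ j else 0)"
      by (intro sum.cong) auto
    finally show ?thesis using that(2) by simp
  qed
  define c where "c = transpose_mat U *\<^sub>v x"
  define d where "d = transpose_mat U *\<^sub>v w"
  have c: "c \<in> carrier_vec n" and d: "d \<in> carrier_vec n" using U x w by (auto simp: c_def d_def)
  have "n > 0"
  proof (rule ccontr)
    assume "\<not> n > 0"
    then show False using w(1,2) by auto
  qed
  have "D *\<^sub>v d = ev 1 \<cdot>\<^sub>v d"
    using diag[OF w(1)] w U by (simp add: d_def mult_mat_vec[of _ n n])
  then have "es ! i * d $ i = ev 1 * d $ i" if "i < n" for i
    using D_entry[OF d that] that d by auto
  \<comment> \<open>Here \<open>ev (Suc i)\<close> differs from \<open>ev 1\<close> by the gap, so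
    the coordinate must vanish.\<close>
  then have d0: "d $ i = 0" if "i < n" "i > 0" for i
    using that es[of i] gap by fastforce
  have "d $ 0 \<noteq> 0"
  proof
    assume "d $ 0 = 0"
    then have "d $ i = 0" if "i < n" for i using d0 that by (cases "i = 0") auto
    then have "d = 0\<^sub>v n" using d by (intro eq_vecI) auto
    moreover have "U *\<^sub>v 0\<^sub>v n = 0\<^sub>v n" using U by (intro eq_vecI) auto
    ultimately show False using expand[OF w(1)] w(2) by (simp add: d_def)
  qed
  moreover have "0 = (\<Sum>i = 0..<n. c $ i * d $ i)"
    using inner[OF x w(1)] orth d by (simp add: c_def[symmetric] d_def[symmetric] scalar_prod_def)
  moreover have "\<dots> = c $ 0 * d $ 0"
    using \<open>n > 0\<close> d0 by (subst sum.remove[of _ 0]) (auto intro!: sum.neutral)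
  ultimately have c0: "c $ 0 = 0" by simp
  have "x \<bullet> (A *\<^sub>v x) = c \<bullet> (D *\<^sub>v c)"
    using inner[OF x, of "A *\<^sub>v x"] A x diag[OF x] by (simp add: c_def)
  also have "\<dots> = (\<Sum>i = 0..<n. es ! i * (c $ i)\<^sup>2)"
    using D c D_entry[OF c] by (simp add: scalar_prod_def power2_eq_square algebra_simps)
  also have "\<dots> \<le> (\<Sum>i = 0..<n. ev 2 * (c $ i)\<^sup>2)"
  proof (rule sum_mono)
    fix i assume "i \<in> {0..<n}"
    \<comment> \<open>The term \<open>i = 0\<close>, whose eigenvalue is \<open>ev 1\<close>, is
      harmless only because \<open>c $ 0 = 0\<close>.\<close>
    then show "es ! i * (c $ i)\<^sup>2 \<le> ev 2 * (c $ i)\<^sup>2"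
      using c0 ev es[of i] A
      by (cases "i = 0") (auto simp: ordered_eigenvalues_def intro!: mult_right_mono)
  qed
  also have "\<dots> = ev 2 * (x \<bullet> x)"
    unfolding inner[OF x x, symmetric] c_def[symmetric] using c
    by (simp add: scalar_prod_def power2_eq_square sum_distrib_left)
  finally show ?thesis .
qed

text \<open>Both lists enumerate the roots of the characteristic polynomial with multiplicity, and a
  multiset has only one sorted enumeration.\<close>

lemma ordered_eigenvalues_unique:
  assumes "ordered_eigenvalues A ev" "ordered_eigenvalues A ev'" and k: "k \<in> {1..dim_row A}"
  shows "ev k = ev' k"
proof -
  let ?es = "\<lambda>ev. map ev [1..<Suc (dim_row A)]"
  have mset_roots: "mset (?es ev) = proots (char_poly A)" if "ordered_eigenvalues A ev" for ev
  proof -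
    have proots: "proots (\<Prod>e\<leftarrow>es. [:- e, 1:]) = mset es" for es :: "real list"
    proof (induction es)
      case (Cons a es)
      have "(\<Prod>e\<leftarrow>es. [:- e, 1:]) \<noteq> 0" by (auto simp: prod_list_zero_iff)
      then show ?case using Cons.IH by (simp add: proots_mult del: mult_pCons_left)
    qed simp
    show ?thesis by (simp only: ordered_eigenvalues_prod_list[OF that] proots)
  qed
  \<comment> \<open>\<open>sorted\<close> means increasing whereas \<open>ev\<close> decreases,
    hence the reversal.\<close>
  have sorted: "sorted (rev (?es ev))" if "ordered_eigenvalues A ev" for ev
    using that unfolding sorted_rev_iff_nth_mono ordered_eigenvalues_def
    by (auto simp: nth_append simp del: upt_Suc)
  have "mset (rev (?es ev)) = mset (rev (?es ev'))"
    by (simp only: mset_rev mset_roots[OF assms(1)] mset_roots[OF assms(2)])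
  then have "rev (?es ev) = rev (?es ev')"
    using sorted[OF assms(1)] sorted[OF assms(2)] properties_for_sort sorted_sort_id by metis
  then show ?thesis using k by (simp del: upt_Suc)
qed


section \<open>Adjacency and the Laplacian form of the stability matrix\<close>

lemma geodist_commute: "geodist x y = geodist y x"
proof -
  have "(\<lambda>k::int. \<bar>x - y + 2 * pi * of_int k\<bar>) ` UNIV = (\<lambda>k::int. \<bar>y - x + 2 * pi * of_int k\<bar>) ` UNIV"
  proof (intro equalityI subsetI)
    fix t assume "t \<in> (\<lambda>k::int. \<bar>x - y + 2 * pi * of_int k\<bar>) ` UNIV"
    then obtain k :: int where "t = \<bar>x - y + 2 * pi * of_int k\<bar>" by auto
    then have "t = \<bar>y - x + 2 * pi * of_int (- k)\<bar>" by simp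
    then show "t \<in> (\<lambda>k::int. \<bar>y - x + 2 * pi * of_int k\<bar>) ` UNIV" by blast
  next
    fix t assume "t \<in> (\<lambda>k::int. \<bar>y - x + 2 * pi * of_int k\<bar>) ` UNIV"
    then obtain k :: int where "t = \<bar>y - x + 2 * pi * of_int k\<bar>" by auto
    then have "t = \<bar>x - y + 2 * pi * of_int (- k)\<bar>" by simp
    then show "t \<in> (\<lambda>k::int. \<bar>x - y + 2 * pi * of_int k\<bar>) ` UNIV" by blast
  qed
  then show ?thesis unfolding geodist_def by simp
qed

lemma adj_commute: "adj \<Delta> \<theta> i j = adj \<Delta> \<theta> j i"
  by (simp add: adj_def geodist_commute)

lemma adj_eq_1_if_same_phase:
  assumes "0 \<le> \<Delta>" and "\<theta> i - \<theta> j = 2 * pi * of_int k"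
  shows "adj \<Delta> \<theta> i j = 1"
proof -
  have "geodist (\<theta> i) (\<theta> j) \<le> \<bar>\<theta> i - \<theta> j + 2 * pi * of_int (- k)\<bar>"
    unfolding geodist_def by (rule cINF_lower) (auto intro!: bdd_belowI[of _ 0])
  then show ?thesis using assms by (simp add: adj_def)
qed

text \<open>These are the edge weights for which the stability matrix is minus a weighted graph
  Laplacian; they can be negative.\<close>

definition coupling :: "real \<Rightarrow> (nat \<Rightarrow> real) \<Rightarrow> nat \<Rightarrow> nat \<Rightarrow> real" where
  "coupling \<Delta> \<theta> i j = adj \<Delta> \<theta> i j * cos (\<theta> i - \<theta> j)"

lemma coupling_commute: "coupling \<Delta> \<theta> i j = coupling \<Delta> \<theta> j i"
  unfolding coupling_def by (metis adj_commute cos_minus minus_diff_eq)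

lemma stability_entry_commute: "stability_entry \<Delta> \<Lambda> \<theta> i j = stability_entry \<Delta> \<Lambda> \<theta> j i"
  using coupling_commute by (auto simp: stability_entry_def coupling_def)

text \<open>The diagonal entry is minus the sum of the other entries in its row. In difference form
  the index \<open>j = i\<close> contributes nothing, so the sum may run over all of
  \<open>\<Lambda>\<close>.\<close>

lemma stability_entry_laplacian:
  assumes "finite \<Lambda>" "i \<in> \<Lambda>"
  shows "(\<Sum>j\<in>\<Lambda>. stability_entry \<Delta> \<Lambda> \<theta> i j * y j) = (\<Sum>j\<in>\<Lambda>. coupling \<Delta> \<theta> i j * (y j - y i))"
proof -
  have "(\<Sum>j\<in>\<Lambda>. stability_entry \<Delta> \<Lambda> \<theta> i j * y j)
      = - (\<Sum>j\<in>\<Lambda> - {i}. coupling \<Delta> \<theta> i j) * y i + (\<Sum>j\<in>\<Lambda> - {i}. coupling \<Delta> \<theta> i j * y j)"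
    using assms by (subst sum.remove[of _ i]) (auto simp: stability_entry_def coupling_def)
  also have "\<dots> = (\<Sum>j\<in>\<Lambda> - {i}. coupling \<Delta> \<theta> i j * (y j - y i))"
    by (simp add: right_diff_distrib sum_subtractf sum_distrib_right)
  also have "\<dots> = (\<Sum>j\<in>\<Lambda>. coupling \<Delta> \<theta> i j * (y j - y i))"
    using assms by (subst (2) sum.remove[of _ i]) auto
  finally show ?thesis .
qed

lemma sum_sorted_list_of_set:
  assumes "finite \<Lambda>"
  shows "(\<Sum>p = 0..<card \<Lambda>. f (sorted_list_of_set \<Lambda> ! p)) = (\<Sum>i\<in>\<Lambda>. f i)"
proof -
  have "bij_betw ((!) (sorted_list_of_set \<Lambda>)) {0..<card \<Lambda>} \<Lambda>"
    using assms by (intro bij_betw_nth) auto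
  then show ?thesis by (rule sum.reindex_bij_betw)
qed

section \<open>Second eigenvalue of a stable cluster\<close>

text \<open>Interpreted twice in the final proof, once for each of the two fixed points.\<close>

locale stable_cluster =
  fixes \<Delta> :: real and \<Lambda> :: "nat set" and \<theta> :: "nat \<Rightarrow> real" and ev :: "nat \<Rightarrow> real"
  assumes finite: "finite \<Lambda>" and card_ge_2: "2 \<le> card \<Lambda>"
    and stable: "linearly_stable \<Delta> \<Lambda> \<theta>"
    and ordered: "ordered_eigenvalues (stability_matrix \<Delta> \<Lambda> \<theta>) ev"
begin

abbreviation J :: "real mat" where "J \<equiv> stability_matrix \<Delta> \<Lambda> \<theta>"

definition vec_of :: "(nat \<Rightarrow> real) \<Rightarrow> real vec" where
  "vec_of x = Matrix.vec (card \<Lambda>) (\<lambda>p. x (sorted_list_of_set \<Lambda> ! p))"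

lemma nth_in: "p < card \<Lambda> \<Longrightarrow> sorted_list_of_set \<Lambda> ! p \<in> \<Lambda>"
  using finite by (metis nth_mem set_sorted_list_of_set length_sorted_list_of_set)

lemma vec_of_carrier [simp]: "vec_of x \<in> carrier_vec (card \<Lambda>)"
  by (simp add: vec_of_def)

lemma vec_of_inner: "vec_of x \<bullet> vec_of y = (\<Sum>i\<in>\<Lambda>. x i * y i)"
  using sum_sorted_list_of_set[OF finite, of "\<lambda>i. x i * y i"] by (simp add: vec_of_def scalar_prod_def)

text \<open>Linear stability only asserts that some ordered eigenvalue list has these signs;
  uniqueness carries them over to the given \<open>ev\<close>.\<close>

lemma ev_1: "ev 1 = 0" and ev_neg: "k \<in> {2..card \<Lambda>} \<Longrightarrow> ev k < 0"
proof -
  have dim: "dim_row J = card \<Lambda>" by (simp add: stability_matrix_def)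
  from stable obtain es where es: "ordered_eigenvalues J es" "es 1 = 0" "\<forall>k\<in>{2..card \<Lambda>}. es k < 0"
    by (auto simp: linearly_stable_def)
  show "ev 1 = 0"
    using ordered_eigenvalues_unique[OF ordered es(1), of 1] es(2) card_ge_2 dim by auto
  show "ev k < 0" if "k \<in> {2..card \<Lambda>}"
    using ordered_eigenvalues_unique[OF ordered es(1), of k] es(3) that dim by auto
qed

lemma J_carrier: "J \<in> carrier_mat (card \<Lambda>) (card \<Lambda>)"
  by (simp add: stability_matrix_def)

lemma J_symmetric: "transpose_mat J = J"
  by (rule eq_matI) (auto simp: stability_matrix_def stability_entry_commute)

lemma J_vec_of: "J *\<^sub>v vec_of y = vec_of (\<lambda>i. \<Sum>j\<in>\<Lambda>. coupling \<Delta> \<theta> i j * (y j - y i))"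
proof (rule eq_vecI)
  fix p assume "p < dim_vec (vec_of (\<lambda>i. \<Sum>j\<in>\<Lambda>. coupling \<Delta> \<theta> i j * (y j - y i)))"
  then have p: "p < card \<Lambda>" by (simp add: vec_of_def)
  let ?i = "sorted_list_of_set \<Lambda> ! p"
  have "(J *\<^sub>v vec_of y) $ p = (\<Sum>j\<in>\<Lambda>. stability_entry \<Delta> \<Lambda> \<theta> ?i j * y j)"
    using p sum_sorted_list_of_set[OF finite, of "\<lambda>j. stability_entry \<Delta> \<Lambda> \<theta> ?i j * y j"]
    by (simp add: stability_matrix_def vec_of_def scalar_prod_def)
  then show "(J *\<^sub>v vec_of y) $ p = vec_of (\<lambda>i. \<Sum>j\<in>\<Lambda>. coupling \<Delta> \<theta> i j * (y j - y i)) $ p"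
    using p stability_entry_laplacian[OF finite nth_in[OF p]] by (simp add: vec_of_def)
qed (simp add: stability_matrix_def vec_of_def)

text \<open>The constant vector spans the top eigenspace, so being orthogonal to it means having sum
  zero.\<close>

lemma rayleigh:
  assumes "(\<Sum>i\<in>\<Lambda>. x i) = 0"
  shows "(\<Sum>i\<in>\<Lambda>. x i * (\<Sum>j\<in>\<Lambda>. coupling \<Delta> \<theta> i j * (x j - x i))) \<le> ev 2 * (\<Sum>i\<in>\<Lambda>. (x i)\<^sup>2)"
proof -
  have "vec_of (\<lambda>_. 1) \<noteq> 0\<^sub>v (card \<Lambda>)"
  proof
    assume "vec_of (\<lambda>_. 1) = 0\<^sub>v (card \<Lambda>)"
    then have "vec_of (\<lambda>_. 1) $ 0 = 0\<^sub>v (card \<Lambda>) $ 0" by simp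
    then show False using card_ge_2 by (simp add: vec_of_def)
  qed
  moreover have "J *\<^sub>v vec_of (\<lambda>_. 1) = ev 1 \<cdot>\<^sub>v vec_of (\<lambda>_. 1)"
    unfolding J_vec_of ev_1 by (rule eq_vecI) (auto simp: vec_of_def)
  moreover have "vec_of x \<bullet> vec_of (\<lambda>_. 1) = 0" using assms by (simp add: vec_of_inner)
  moreover have "\<forall>k\<in>{2..card \<Lambda>}. ev k < ev 1" using ev_neg ev_1 by simp
  ultimately have "vec_of x \<bullet> (J *\<^sub>v vec_of x) \<le> ev 2 * (vec_of x \<bullet> vec_of x)"
    by (intro rayleigh_second_eigenvalue[OF J_carrier J_symmetric ordered, where w = "vec_of (\<lambda>_. 1)"]) auto
  then show ?thesis by (simp add: J_vec_of vec_of_inner power2_eq_square)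
qed

text \<open>Summed over all oscillators, the left sides of the eigenvector equations cancel by
  symmetry of the weights. As \<open>ev 2\<close> is nonzero, the entries of the eigenvector sum to
  zero.\<close>

lemma eigenvector_2:
  "\<exists>y. (\<exists>i\<in>\<Lambda>. y i \<noteq> 0) \<and> (\<Sum>i\<in>\<Lambda>. y i) = 0 \<and>
     (\<forall>i\<in>\<Lambda>. (\<Sum>j\<in>\<Lambda>. coupling \<Delta> \<theta> i j * (y j - y i)) = ev 2 * y i)"
proof -
  have dim: "dim_row J = card \<Lambda>" by (simp add: stability_matrix_def)
  have "poly (char_poly J) (ev 2) = (\<Prod>k = 1..card \<Lambda>. ev 2 - ev k)"
    using ordered by (simp add: ordered_eigenvalues_def poly_prod dim)
  also have "\<dots> = 0" using card_ge_2 by (intro prod_zero) auto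
  finally have "eigenvalue J (ev 2)" using eigenvalue_root_char_poly[OF J_carrier] by simp
  then obtain v where v: "v \<in> carrier_vec (card \<Lambda>)" "v \<noteq> 0\<^sub>v (card \<Lambda>)" "J *\<^sub>v v = ev 2 \<cdot>\<^sub>v v"
    using J_carrier by (auto simp: eigenvalue_def eigenvector_def)
  have bij: "bij_betw ((!) (sorted_list_of_set \<Lambda>)) {0..<card \<Lambda>} \<Lambda>"
    using finite by (intro bij_betw_nth) auto
  \<comment> \<open>Inverting the enumeration turns the matrix eigenvector into a function on
    oscillators.\<close>
  define y where "y i = v $ (the_inv_into {0..<card \<Lambda>} ((!) (sorted_list_of_set \<Lambda>)) i)" for i
  have y_nth: "y (sorted_list_of_set \<Lambda> ! p) = v $ p" if "p < card \<Lambda>" for p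
    using that bij by (simp add: y_def bij_betw_def the_inv_into_f_f)
  have vy: "v = vec_of y" by (rule eq_vecI) (use v(1) y_nth in \<open>auto simp: vec_of_def\<close>)
  from v(1,2) obtain p where p: "p < card \<Lambda>" "v $ p \<noteq> 0"
    by (metis eq_vecI carrier_vecD index_zero_vec)
  have eq: "(\<Sum>j\<in>\<Lambda>. coupling \<Delta> \<theta> i j * (y j - y i)) = ev 2 * y i" if "i \<in> \<Lambda>" for i
  proof -
    from that bij obtain q where q: "q < card \<Lambda>" "i = sorted_list_of_set \<Lambda> ! q"
      by (force simp: bij_betw_def image_iff)
    from v(3) have "(J *\<^sub>v vec_of y) $ q = (ev 2 \<cdot>\<^sub>v vec_of y) $ q" by (simp add: vy)
    then show ?thesis unfolding J_vec_of using q by (simp add: vec_of_def)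
  qed
  have "ev 2 * (\<Sum>i\<in>\<Lambda>. y i) = (\<Sum>i\<in>\<Lambda>. \<Sum>j\<in>\<Lambda>. coupling \<Delta> \<theta> i j * (y j - y i))"
    by (simp add: sum_distrib_left eq)
  also have "\<dots> = (\<Sum>i\<in>\<Lambda>. \<Sum>j\<in>\<Lambda>. coupling \<Delta> \<theta> i j * y j) - (\<Sum>i\<in>\<Lambda>. \<Sum>j\<in>\<Lambda>. coupling \<Delta> \<theta> i j * y i)"
    by (simp add: right_diff_distrib sum_subtractf)
  also have "(\<Sum>i\<in>\<Lambda>. \<Sum>j\<in>\<Lambda>. coupling \<Delta> \<theta> i j * y i) = (\<Sum>i\<in>\<Lambda>. \<Sum>j\<in>\<Lambda>. coupling \<Delta> \<theta> i j * y j)"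
    by (subst sum.swap) (simp add: coupling_commute)
  finally have "(\<Sum>i\<in>\<Lambda>. y i) = 0" using ev_neg[of 2] card_ge_2 by simp
  moreover have "y (sorted_list_of_set \<Lambda> ! p) \<noteq> 0" using y_nth[OF p(1)] p(2) by simp
  ultimately show ?thesis
    using nth_in[OF p(1)] eq by (intro exI[of _ y] conjI ballI bexI[of _ "sorted_list_of_set \<Lambda> ! p"])
qed


text \<open>The test function is 1 on \<open>P\<close> and -1 on \<open>M\<close>; it has sum zero
  because the groups have equal size. Only mixed pairs contribute: each gives -2 times its weight
  from either end, hence the factor -4, and the squared norm is \<open>2 * n\<close>.\<close>

lemma rayleigh_two_groups:
  assumes \<Lambda>: "\<Lambda> = P \<union> M" "P \<inter> M = {}" and card: "card P = n" "card M = n"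
  shows "- 4 * (\<Sum>i\<in>P. \<Sum>j\<in>M. coupling \<Delta> \<theta> i j) \<le> ev 2 * (2 * real n)"
proof -
  have fin: "finite P" "finite M" using finite \<Lambda> by auto
  define x :: "nat \<Rightarrow> real" where "x i = (if i \<in> P then 1 else - 1)" for i
  have xP: "x i = 1" if "i \<in> P" for i using that by (simp add: x_def)
  have xM: "x i = - 1" if "i \<in> M" for i using that \<Lambda>(2) by (auto simp: x_def)
  have split: "(\<Sum>i\<in>\<Lambda>. f i) = (\<Sum>i\<in>P. f i) + (\<Sum>i\<in>M. f i)" for f :: "nat \<Rightarrow> real"
    unfolding \<Lambda>(1) using fin \<Lambda>(2) by (rule sum.union_disjoint)
  have "(\<Sum>i\<in>\<Lambda>. x i) = (\<Sum>i\<in>P. 1) + (\<Sum>i\<in>M. - 1)"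
    unfolding split using xP xM by (intro arg_cong2[of _ _ _ _ "(+)"] sum.cong) auto
  then have sum0: "(\<Sum>i\<in>\<Lambda>. x i) = 0" by (simp add: card)
  have "(\<Sum>i\<in>\<Lambda>. (x i)\<^sup>2) = (\<Sum>i\<in>P. 1) + (\<Sum>i\<in>M. 1)"
    unfolding split[of "\<lambda>i. (x i)\<^sup>2"] using xP xM
    by (intro arg_cong2[of _ _ _ _ "(+)"] sum.cong) auto
  then have norm: "(\<Sum>i\<in>\<Lambda>. (x i)\<^sup>2) = 2 * real n" by (simp add: card)
  have le: "(\<Sum>i\<in>\<Lambda>. x i * (\<Sum>j\<in>\<Lambda>. coupling \<Delta> \<theta> i j * (x j - x i))) \<le> ev 2 * (2 * real n)"
    using rayleigh[OF sum0] unfolding norm .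
  have swap: "(\<Sum>i\<in>M. \<Sum>j\<in>P. coupling \<Delta> \<theta> i j) = (\<Sum>i\<in>P. \<Sum>j\<in>M. coupling \<Delta> \<theta> i j)"
    by (subst sum.swap) (simp add: coupling_commute)
  have P_term: "x i * (\<Sum>j\<in>\<Lambda>. coupling \<Delta> \<theta> i j * (x j - x i)) = - 2 * (\<Sum>j\<in>M. coupling \<Delta> \<theta> i j)"
    if i: "i \<in> P" for i
  proof -
    have "(\<Sum>j\<in>\<Lambda>. coupling \<Delta> \<theta> i j * (x j - x i)) = (\<Sum>j\<in>P. 0) + - 2 * (\<Sum>j\<in>M. coupling \<Delta> \<theta> i j)"
      unfolding sum_distrib_left split[of "\<lambda>j. coupling \<Delta> \<theta> i j * (x j - x i)"] using xP xM i
      by (intro arg_cong2[of _ _ _ _ "(+)"] sum.cong) auto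
    then show ?thesis by (simp add: xP[OF i])
  qed
  have M_term: "x i * (\<Sum>j\<in>\<Lambda>. coupling \<Delta> \<theta> i j * (x j - x i)) = - 2 * (\<Sum>j\<in>P. coupling \<Delta> \<theta> i j)"
    if i: "i \<in> M" for i
  proof -
    have "(\<Sum>j\<in>\<Lambda>. coupling \<Delta> \<theta> i j * (x j - x i)) = 2 * (\<Sum>j\<in>P. coupling \<Delta> \<theta> i j) + (\<Sum>j\<in>M. 0)"
      unfolding sum_distrib_left split[of "\<lambda>j. coupling \<Delta> \<theta> i j * (x j - x i)"] using xP xM i
      by (intro arg_cong2[of _ _ _ _ "(+)"] sum.cong) auto
    then show ?thesis by (simp add: xM[OF i])
  qed
  have "(\<Sum>i\<in>\<Lambda>. x i * (\<Sum>j\<in>\<Lambda>. coupling \<Delta> \<theta> i j * (x j - x i)))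
      = (\<Sum>i\<in>P. - 2 * (\<Sum>j\<in>M. coupling \<Delta> \<theta> i j)) + (\<Sum>i\<in>M. - 2 * (\<Sum>j\<in>P. coupling \<Delta> \<theta> i j))"
    unfolding split[of "\<lambda>i. x i * (\<Sum>j\<in>\<Lambda>. coupling \<Delta> \<theta> i j * (x j - x i))"]
    by (intro arg_cong2[of _ _ _ _ "(+)"] sum.cong refl P_term M_term)
  also have "\<dots> = - 4 * (\<Sum>i\<in>P. \<Sum>j\<in>M. coupling \<Delta> \<theta> i j)"
    unfolding sum_distrib_left[symmetric] swap by linarith
  finally have eq: "(\<Sum>i\<in>\<Lambda>. x i * (\<Sum>j\<in>\<Lambda>. coupling \<Delta> \<theta> i j * (x j - x i)))
      = - 4 * (\<Sum>i\<in>P. \<Sum>j\<in>M. coupling \<Delta> \<theta> i j)" .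
  show ?thesis using le unfolding eq .
qed

text \<open>Besides the constant mode there are the difference of the two groups, with eigenvalue
  \<open>- 2 * n * c\<close>, and the sum-zero modes inside one group, with eigenvalue
  \<open>- n * (1 + c)\<close>. The former is the larger one since \<open>c \<le> 1\<close>. The
  proof shows that a sum-zero eigenvector with a still larger eigenvalue would vanish on both
  groups.\<close>

lemma two_group_eigenvalue:
  assumes \<Lambda>: "\<Lambda> = P \<union> M" "P \<inter> M = {}" and card: "card P = n" "card M = n"
    and PP: "\<And>i j. i \<in> P \<Longrightarrow> j \<in> P \<Longrightarrow> coupling \<Delta> \<theta> i j = 1"
    and MM: "\<And>i j. i \<in> M \<Longrightarrow> j \<in> M \<Longrightarrow> coupling \<Delta> \<theta> i j = 1"
    and PM: "\<And>i j. i \<in> P \<Longrightarrow> j \<in> M \<Longrightarrow> coupling \<Delta> \<theta> i j = c"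
    and c: "c \<le> 1"
  shows "ev 2 \<le> - 2 * real n * c"
proof (rule ccontr)
  assume "\<not> ?thesis"
  then have less: "real n * (1 - c) < ev 2 + real n * (1 + c)" by (simp add: algebra_simps)
  have fin: "finite P" "finite M" using finite \<Lambda> by auto
  have split: "(\<Sum>i\<in>\<Lambda>. f i) = (\<Sum>i\<in>P. f i) + (\<Sum>i\<in>M. f i)" for f :: "nat \<Rightarrow> real"
    unfolding \<Lambda>(1) using fin \<Lambda>(2) by (rule sum.union_disjoint)
  obtain y i where i: "i \<in> \<Lambda>" "y i \<noteq> 0" and sum0: "(\<Sum>i\<in>\<Lambda>. y i) = 0"
    and eigen: "\<And>i. i \<in> \<Lambda> \<Longrightarrow> (\<Sum>j\<in>\<Lambda>. coupling \<Delta> \<theta> i j * (y j - y i)) = ev 2 * y i"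
    using eigenvector_2 by meson
  \<comment> \<open>Stated for a generic pair of groups, to be used for \<open>P\<close> against
    \<open>M\<close> and for \<open>M\<close> against \<open>P\<close>.\<close>
  have zero: "\<forall>k\<in>A. y k = 0"
    if A: "A \<union> B = \<Lambda>" "A \<inter> B = {}" "card A = n" "card B = n"
      and AA: "\<And>i j. i \<in> A \<Longrightarrow> j \<in> A \<Longrightarrow> coupling \<Delta> \<theta> i j = 1"
      and AB: "\<And>i j. i \<in> A \<Longrightarrow> j \<in> B \<Longrightarrow> coupling \<Delta> \<theta> i j = c" for A B
  proof -
    have finAB: "finite A" "finite B" using A(1) finite by auto
    have splitAB: "(\<Sum>i\<in>\<Lambda>. f i) = (\<Sum>i\<in>A. f i) + (\<Sum>i\<in>B. f i)" for f :: "nat \<Rightarrow> real"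
      unfolding A(1)[symmetric] using finAB A(2) by (rule sum.union_disjoint)
    have B: "(\<Sum>j\<in>B. y j) = - (\<Sum>j\<in>A. y j)" using sum0 splitAB[of y] by simp
    have each: "(1 - c) * (\<Sum>j\<in>A. y j) = (ev 2 + real n * (1 + c)) * y k" if k: "k \<in> A" for k
    proof -
      have "ev 2 * y k = (\<Sum>j\<in>\<Lambda>. coupling \<Delta> \<theta> k j * (y j - y k))" using eigen[of k] k A(1) by auto
      also have "\<dots> = (\<Sum>j\<in>A. y j - y k) + c * (\<Sum>j\<in>B. y j - y k)"
        unfolding splitAB sum_distrib_left using AA AB k
        by (intro arg_cong2[of _ _ _ _ "(+)"] sum.cong) auto
      finally have "ev 2 * y k = \<dots>" .
      then show ?thesis by (simp add: sum_subtractf A B algebra_simps)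
    qed
    \<comment> \<open>Summing over the group yields the group sum with two different coefficients,
      so it is zero. Then \<open>each\<close> makes every single entry zero, as its coefficient is
      positive.\<close>
    then have "(\<Sum>k\<in>A. (1 - c) * (\<Sum>j\<in>A. y j)) = (\<Sum>k\<in>A. (ev 2 + real n * (1 + c)) * y k)"
      by simp
    then have "real n * (1 - c) * (\<Sum>j\<in>A. y j) = (ev 2 + real n * (1 + c)) * (\<Sum>j\<in>A. y j)"
      by (simp only: sum_distrib_left[symmetric] sum_constant A(3) mult.left_commute mult.assoc)
    moreover have "real n * (1 - c) \<noteq> ev 2 + real n * (1 + c)" using less by (rule less_imp_neq)
    ultimately have "(\<Sum>j\<in>A. y j) = 0" by (metis mult_right_cancel)
    moreover have "ev 2 + real n * (1 + c) \<noteq> 0"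
    proof -
      have "0 \<le> real n * (1 - c)" using c by (intro mult_nonneg_nonneg) auto
      with less show ?thesis by linarith
    qed
    ultimately show ?thesis using each by (metis mult_eq_0_iff mult_zero_right)
  qed
  have "\<forall>k\<in>P. y k = 0" using zero[OF \<Lambda>(1)[symmetric] \<Lambda>(2) card PP PM] by blast
  moreover have MP: "coupling \<Delta> \<theta> i j = c" if "i \<in> M" "j \<in> P" for i j
    using PM[OF that(2,1)] by (metis coupling_commute)
  have "M \<union> P = \<Lambda>" "M \<inter> P = {}" using \<Lambda> by auto
  then have "\<forall>k\<in>M. y k = 0"
    using zero[OF _ _ card(2,1) MM MP] by blast
  ultimately show False using i \<Lambda> by auto
qed

end

section \<open>Sine and cosine sums over mixed pairs\<close>

text \<open>Summing the fixed-point equations over \<open>P\<close>, the interactions inside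
  \<open>P\<close> cancel because the sine is odd. The remaining cross sum does not depend on the
  fixed point, which links the sparse state to the all-to-all state.\<close>

lemma cross_coupling_balance:
  assumes fp: "cluster_fixed_point N \<Delta> \<omega> \<Lambda> \<theta>" and N: "N > 0"
    and fin: "finite \<Lambda>" and \<Lambda>: "\<Lambda> = P \<union> M" "P \<inter> M = {}" and \<omega>: "\<And>i. i \<in> P \<Longrightarrow> \<omega> i = \<omega>\<^sub>0"
  shows "(\<Sum>i\<in>P. \<Sum>j\<in>M. adj \<Delta> \<theta> i j * sin (\<theta> i - \<theta> j)) = real (card P) * real N * \<omega>\<^sub>0"
proof -
  let ?f = "\<lambda>i j. adj \<Delta> \<theta> i j * sin (\<theta> i - \<theta> j)"
  have finPM: "finite P" "finite M" using fin \<Lambda> by auto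
  have anti: "?f i j = - ?f j i" for i j
    by (metis adj_commute minus_diff_eq mult_minus_right sin_minus)
  have "(\<Sum>i\<in>P. \<Sum>j\<in>P. ?f i j) = (\<Sum>i\<in>P. \<Sum>j\<in>P. ?f j i)" by (rule sum.swap)
  also have "\<dots> = - (\<Sum>i\<in>P. \<Sum>j\<in>P. ?f i j)" by (subst anti) (simp add: sum_negf)
  finally have PP: "(\<Sum>i\<in>P. \<Sum>j\<in>P. ?f i j) = 0" by simp
  have "(\<Sum>j\<in>\<Lambda>. ?f i j) = real N * \<omega>\<^sub>0" if "i \<in> P" for i
  proof -
    have "\<omega>\<^sub>0 = 1 / real N * (\<Sum>j\<in>\<Lambda>. ?f i j)"
      using fp that \<omega>[OF that] \<Lambda>(1) by (auto simp: cluster_fixed_point_def)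
    then show ?thesis using N by (simp add: field_simps)
  qed
  then have "(\<Sum>i\<in>P. \<Sum>j\<in>\<Lambda>. ?f i j) = real (card P) * real N * \<omega>\<^sub>0" by simp
  moreover have "(\<Sum>i\<in>P. \<Sum>j\<in>\<Lambda>. ?f i j) = (\<Sum>i\<in>P. \<Sum>j\<in>P. ?f i j) + (\<Sum>i\<in>P. \<Sum>j\<in>M. ?f i j)"
    unfolding \<Lambda>(1) by (simp add: sum.union_disjoint[OF finPM \<Lambda>(2)] sum.distrib)
  ultimately show ?thesis using PP by simp
qed

text \<open>Each summand is at most 1. If all were 1, every mixed pair would be linked with phase
  difference \<open>\<phi>\<close> modulo \<open>2 * pi\<close>; each group would then share one
  phase, and the graph would be complete.\<close>

lemma sparse_cross_coupling_less:
  assumes "0 \<le> \<Delta>" and fin: "finite P" "finite M" and ne: "P \<noteq> {}" "M \<noteq> {}"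
    and incomplete: "\<not> complete_graph \<Delta> (P \<union> M) \<theta>"
  shows "(\<Sum>i\<in>P. \<Sum>j\<in>M. adj \<Delta> \<theta> i j * cos (\<theta> i - \<theta> j - \<phi>)) < real (card P) * real (card M)"
proof -
  let ?g = "\<lambda>i j. adj \<Delta> \<theta> i j * cos (\<theta> i - \<theta> j - \<phi>)"
  have le: "?g i j \<le> 1" for i j by (simp add: adj_def)
  have "\<exists>i\<in>P. \<exists>j\<in>M. ?g i j \<noteq> 1"
  proof (rule ccontr)
    assume "\<not> ?thesis"
    then have one: "?g i j = 1" if "i \<in> P" "j \<in> M" for i j using that by blast
    \<comment> \<open>An unlinked pair would contribute 0 instead of 1.\<close>
    then have adj1: "adj \<Delta> \<theta> i j = 1" if "i \<in> P" "j \<in> M" for i j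
      using that by (fastforce simp: adj_def split: if_splits)
    have phase: "\<exists>k::int. \<theta> i - \<theta> j = \<phi> + 2 * pi * of_int k" if "i \<in> P" "j \<in> M" for i j
    proof -
      have "cos (\<theta> i - \<theta> j - \<phi>) = 1" using one[OF that] adj1[OF that] by simp
      then obtain k :: int where "\<theta> i - \<theta> j - \<phi> = of_int k * 2 * pi" using cos_one_2pi_int by blast
      then show ?thesis by (intro exI[of _ k]) (simp add: algebra_simps)
    qed
    have same: "adj \<Delta> \<theta> i i' = 1" if "\<theta> i - \<psi> = 2 * pi * of_int k" "\<theta> i' - \<psi> = 2 * pi * of_int k'"
      for i i' \<psi> k k'
      using that adj_eq_1_if_same_phase[OF assms(1), of \<theta> i i' "k - k'"] by (simp add: algebra_simps)
    \<comment> \<open>One oscillator of each group serves as the phase reference for the opposite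
      group.\<close>
    from ne obtain p m where p: "p \<in> P" and m: "m \<in> M" by auto
    have "adj \<Delta> \<theta> i i' = 1" if ii': "i \<in> P" "i' \<in> P" for i i'
    proof -
      obtain k k' :: int where "\<theta> i - \<theta> m = \<phi> + 2 * pi * of_int k" "\<theta> i' - \<theta> m = \<phi> + 2 * pi * of_int k'"
        using phase ii' m by meson
      then show ?thesis using same[of i "\<theta> m + \<phi>" k i' k'] by (simp add: algebra_simps)
    qed
    moreover have "adj \<Delta> \<theta> j j' = 1" if jj': "j \<in> M" "j' \<in> M" for j j'
    proof -
      obtain k k' :: int where "\<theta> p - \<theta> j = \<phi> + 2 * pi * of_int k" "\<theta> p - \<theta> j' = \<phi> + 2 * pi * of_int k'"
        using phase jj' p by meson
      then show ?thesis using same[of j "\<theta> p - \<phi>" "- k" j' "- k'"] by (simp add: algebra_simps)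
    qed
    ultimately have "complete_graph \<Delta> (P \<union> M) \<theta>"
      using adj1 unfolding complete_graph_def by (metis Un_iff adj_commute)
    with incomplete show False ..
  qed
  then obtain i j where ij: "i \<in> P" "j \<in> M" "?g i j < 1" using le by (metis order_less_le)
  have "(\<Sum>(i, j)\<in>P \<times> M. ?g i j) < (\<Sum>(i, j)\<in>P \<times> M. 1)"
    by (rule sum_strict_mono_ex1) (use fin le ij in auto)
  then show ?thesis by (simp add: sum.cartesian_product[symmetric] card_cartesian_product)
qed


section \<open>Comparison of the two fixed points\<close>

lemma rcong_2pi_diff:
  assumes "[x = a] (rmod (2 * pi))" and "[y = b] (rmod (2 * pi))"
  shows "\<exists>k::int. x - y = a - b + 2 * pi * of_int k"
proof -
  have "[a - b = x - y] (rmod (2 * pi))"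
    using rcong_diff[OF rcong_sym[OF assms(1)] rcong_sym[OF assms(2)]] .
  then show ?thesis unfolding rcong_altdef by (simp add: mult.commute)
qed

lemma sin_plus_2pi_int: "sin (x + 2 * pi * of_int k) = sin x"
  and cos_plus_2pi_int: "cos (x + 2 * pi * of_int k) = cos x"
  by (simp_all add: sin_add cos_add)

theorem mainTheorem4:
  fixes N n :: nat
    and \<Delta> \<omega>\<^sub>0 :: real
    and \<omega> :: "nat \<Rightarrow> real"
    and Iplus Iminus \<Lambda> :: "nat set"
    and \<theta> \<theta>' :: "nat \<Rightarrow> real"
    and ev ev' :: "nat \<Rightarrow> real"
  assumes "even N" and "n \<ge> 1" and "2 * n \<le> N"
    and "0 \<le> \<Delta>" and "\<Delta> \<le> pi" and "\<omega>\<^sub>0 \<ge> 0"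
    and "Iplus \<union> Iminus = {1..N}" and "Iplus \<inter> Iminus = {}"
    and "\<forall>i\<in>Iplus. \<omega> i = \<omega>\<^sub>0" and "\<forall>i\<in>Iminus. \<omega> i = - \<omega>\<^sub>0"
    and "\<Lambda> \<subseteq> {1..N}" and "card (\<Lambda> \<inter> Iplus) = n" and "card (\<Lambda> \<inter> Iminus) = n"
    and "cluster_fixed_point N \<Delta> \<omega> \<Lambda> \<theta>" and "all_to_all_config \<Delta> Iplus Iminus \<Lambda> \<theta>"
    and "linearly_stable \<Delta> \<Lambda> \<theta>"
    and "cluster_fixed_point N \<Delta> \<omega> \<Lambda> \<theta>'" and "sparse_config \<Delta> \<Lambda> \<theta>'"
    and "linearly_stable \<Delta> \<Lambda> \<theta>'"
    and "ordered_eigenvalues (stability_matrix \<Delta> \<Lambda> \<theta>) ev"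
    and "ordered_eigenvalues (stability_matrix \<Delta> \<Lambda> \<theta>') ev'"
  shows "ev 2 < ev' 2"
proof -
  define P M where "P = \<Lambda> \<inter> Iplus" and "M = \<Lambda> \<inter> Iminus"
  have \<Lambda>: "\<Lambda> = P \<union> M" "P \<inter> M = {}" using assms by (auto simp: P_def M_def)
  have card: "card P = n" "card M = n" using assms by (auto simp: P_def M_def)
  have fin: "finite P" "finite M" "finite \<Lambda>"
    using finite_subset[OF \<open>\<Lambda> \<subseteq> {1..N}\<close>] by (auto simp: P_def M_def)
  have card\<Lambda>: "card \<Lambda> = 2 * n" using card_Un_disjoint[OF fin(1,2) \<Lambda>(2)] card \<Lambda>(1) by simp
  have ne: "P \<noteq> {}" "M \<noteq> {}" using card \<open>n \<ge> 1\<close> by auto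
  have N: "N > 0" using assms(2,3) by simp
  interpret a: stable_cluster \<Delta> \<Lambda> \<theta> ev
    by unfold_locales (use fin card\<Lambda> assms in auto)
  interpret s: stable_cluster \<Delta> \<Lambda> \<theta>' ev'
    by unfold_locales (use fin card\<Lambda> assms in auto)
  have \<omega>: "\<omega> i = \<omega>\<^sub>0" if "i \<in> P" for i using assms that by (auto simp: P_def)

  from \<open>all_to_all_config \<Delta> Iplus Iminus \<Lambda> \<theta>\<close> obtain tp tm where
    complete: "complete_graph \<Delta> \<Lambda> \<theta>"
    and tp: "\<And>i. i \<in> P \<Longrightarrow> [\<theta> i = tp] (rmod (2 * pi))"
    and tm: "\<And>i. i \<in> M \<Longrightarrow> [\<theta> i = tm] (rmod (2 * pi))"
    unfolding all_to_all_config_def P_def M_def by blast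
  define \<phi> where "\<phi> = tp - tm"
  have adj1: "adj \<Delta> \<theta> i j = 1" if "i \<in> \<Lambda>" "j \<in> \<Lambda>" for i j
    using complete that by (simp add: complete_graph_def)
  have PP: "coupling \<Delta> \<theta> i j = 1" if "i \<in> P" "j \<in> P" for i j
  proof -
    from that obtain k :: int where "\<theta> i - \<theta> j = tp - tp + 2 * pi * of_int k"
      using rcong_2pi_diff[OF tp tp] by blast
    then show ?thesis using adj1 that \<Lambda>(1) cos_plus_2pi_int[of 0 k] by (simp add: coupling_def)
  qed
  have MM: "coupling \<Delta> \<theta> i j = 1" if "i \<in> M" "j \<in> M" for i j
  proof -
    from that obtain k :: int where "\<theta> i - \<theta> j = tm - tm + 2 * pi * of_int k"
      using rcong_2pi_diff[OF tm tm] by blast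
    then show ?thesis using adj1 that \<Lambda>(1) cos_plus_2pi_int[of 0 k] by (simp add: coupling_def)
  qed
  have PM: "coupling \<Delta> \<theta> i j = cos \<phi>" "adj \<Delta> \<theta> i j * sin (\<theta> i - \<theta> j) = sin \<phi>"
    if "i \<in> P" "j \<in> M" for i j
  proof -
    from that obtain k :: int where "\<theta> i - \<theta> j = \<phi> + 2 * pi * of_int k"
      unfolding \<phi>_def using rcong_2pi_diff[OF tp tm] by blast
    then show "coupling \<Delta> \<theta> i j = cos \<phi>" "adj \<Delta> \<theta> i j * sin (\<theta> i - \<theta> j) = sin \<phi>"
      using adj1 that \<Lambda>(1) by (simp_all add: coupling_def sin_plus_2pi_int cos_plus_2pi_int)
  qed

  have ev2: "ev 2 \<le> - 2 * real n * cos \<phi>"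
    by (rule a.two_group_eigenvalue[OF \<Lambda> card PP MM PM(1)]) auto
  have "(\<Sum>i\<in>P. \<Sum>j\<in>M. coupling \<Delta> \<theta> i j) = (\<Sum>i\<in>P. \<Sum>j\<in>M. cos \<phi>)"
    by (intro sum.cong refl PM(1))
  then have sum_a: "(\<Sum>i\<in>P. \<Sum>j\<in>M. coupling \<Delta> \<theta> i j) = real n * (real n * cos \<phi>)"
    by (simp add: card)
  \<comment> \<open>Stability of the all-to-all state yields \<open>cos \<phi> > 0\<close>: the
    test-function bound reads \<open>- 4 * n\<^sup>2 * cos \<phi> \<le> 2 * n * ev 2\<close>, and
    its right side is negative.\<close>
  have "ev 2 < 0" using a.ev_neg[of 2] a.card_ge_2 by simp
  then have "ev 2 * (2 * real n) < 0" using \<open>n \<ge> 1\<close> by (simp add: mult_neg_pos)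
  then have "0 < real n * (real n * cos \<phi>)" using a.rayleigh_two_groups[OF \<Lambda> card] sum_a by linarith
  then have c: "cos \<phi> > 0" by (simp add: zero_less_mult_iff)

  have "(\<Sum>i\<in>P. \<Sum>j\<in>M. adj \<Delta> \<theta> i j * sin (\<theta> i - \<theta> j)) = (\<Sum>i\<in>P. \<Sum>j\<in>M. sin \<phi>)"
    by (intro sum.cong refl PM(2))
  \<comment> \<open>Both fixed points have the cross sine sum
    \<open>n * N * \<omega>\<^sub>0\<close>, so the sparse one equals the explicit all-to-all
    one.\<close>
  then have balance: "(\<Sum>i\<in>P. \<Sum>j\<in>M. adj \<Delta> \<theta>' i j * sin (\<theta>' i - \<theta>' j)) = real n * (real n * sin \<phi>)"
    using cross_coupling_balance[OF _ N fin(3) \<Lambda> \<omega>] assms(14,17) by (simp add: card)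
  define S where "S = (\<Sum>i\<in>P. \<Sum>j\<in>M. coupling \<Delta> \<theta>' i j)"
  have cos_split: "a * cos (x - \<phi>) = cos \<phi> * (a * cos x) + sin \<phi> * (a * sin x)" for a x
    by (simp add: cos_diff algebra_simps)
  have "(\<Sum>i\<in>P. \<Sum>j\<in>M. adj \<Delta> \<theta>' i j * cos (\<theta>' i - \<theta>' j - \<phi>))
      = cos \<phi> * S + sin \<phi> * (\<Sum>i\<in>P. \<Sum>j\<in>M. adj \<Delta> \<theta>' i j * sin (\<theta>' i - \<theta>' j))"
    unfolding S_def sum_distrib_left sum.distrib[symmetric]
    by (intro sum.cong refl) (simp only: coupling_def cos_split)
  moreover have "(\<Sum>i\<in>P. \<Sum>j\<in>M. adj \<Delta> \<theta>' i j * cos (\<theta>' i - \<theta>' j - \<phi>)) < real n * real n"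
    using sparse_cross_coupling_less[OF \<open>0 \<le> \<Delta>\<close> fin(1,2) ne, of \<theta>' \<phi>] assms(18) \<Lambda>(1) card
    by (simp add: sparse_config_def)
  ultimately have "cos \<phi> * S + real n * real n * (sin \<phi>)\<^sup>2 < real n * real n"
    by (simp add: balance power2_eq_square algebra_simps)
  \<comment> \<open>Moving the sine term to the right leaves
    \<open>n\<^sup>2 * (cos \<phi>)\<^sup>2\<close>; one factor \<open>cos \<phi>\<close> is then
    cancelled, using its positivity.\<close>
  then have "cos \<phi> * S < cos \<phi> * (real n * real n * cos \<phi>)"
    unfolding sin_squared_eq by (simp add: power2_eq_square algebra_simps)
  then have S: "S < real n * real n * cos \<phi>" using c by (simp add: mult_less_cancel_left_pos)
  have "- 4 * S \<le> ev' 2 * (2 * real n)" unfolding S_def by (rule s.rayleigh_two_groups[OF \<Lambda> card])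
  \<comment> \<open>Thus \<open>- 2 * n * cos \<phi>\<close> separates the eigenvalues: it bounds
    \<open>ev 2\<close> from above and lies strictly below \<open>ev' 2\<close>.\<close>
  with S have "real n * (- 2 * real n * cos \<phi>) < real n * ev' 2" by (simp add: algebra_simps)
  then have "- 2 * real n * cos \<phi> < ev' 2" by (rule mult_left_less_imp_less) simp
  with ev2 show ?thesis by simp
qed

end
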